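(* Let $s \ge 2$ be an integer, let $(U_n)_{n\ge 0}$ be the multibonacci ($s$-bonacci) sequence, and let $X$ be the location of the end (last black cell) of the first black string whose length is of the form $sk+(s-1)$ with $k\ge 0$ an integer, in an infinite board with cells $1,2,3,\ldots$ each coloured black or white independently with probability $1/2$ each. Then for every integer $n \ge s-1$, $$P(X=n) = \frac{U_{n-s+2}}{2^{n+1}}.$$ As a consequence, $$\sum_{n \ge s-1} \frac{U_{n-s+2}}{2^n} = 2.$$
   Context: Fix an integer $s\ge 2$. The multibonacci ($s$-bonacci) numbers are defined by $U_0=0$ and, for $n\ge 0$, $U_{n+1}$ is the number of compositions (ordered sums) of $n$ with all parts in $\{1,2,\ldots,s\}$ (so $U_1=1$, from the empty composition of $0$, and $U_2=1$, $U_3=2$). Equivalently, $U_n$ for $n\ge1$ is the number of ways to tile a board of length $n-1$ with $1$-ominoes, $2$-ominoes, $\ldots$, $s$-ominoes; for $n\ge s$ one has $U_{n+1}=U_n+U_{n-1}+\cdots+U_{n-s+1}$. Random model: cells of an infinite board are numbered $1,2,3,\ldots$ and each is independently coloured black or white with probability $1/2$ each. A black string is a maximal run of consecutive black cells (bounded on the right by a white cell, and on the left by a white cell or by the beginning of the board); its length is its number of cells. The random variable $X$ is the index of the last black cell of the first (leftmost) black string whose length equals $sk+(s-1)$ for some integer $k\ge 0$, i.e. whose length is congruent to $s-1$ modulo $s$ (with $X=\infty$ if there is no such string). *)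

theory Defs
  imports "HOL-Probability.Probability"
begin

text \<open>Compositions are lists of parts, listed in order.\<close>

definition compositions :: "nat \<Rightarrow> nat \<Rightarrow> nat list set" where
  "compositions s n = {ps. set ps \<subseteq> {1..s} \<and> sum_list ps = n}"

fun multibonacci :: "nat \<Rightarrow> nat \<Rightarrow> nat" where
  "multibonacci s 0 = 0"
| "multibonacci s (Suc n) = card (compositions s n)"

text \<open>The cells are \<open>1, 2, 3, \<dots>\<close> and \<open>True\<close> means black. Points of the product space are
  extensional functions on \<open>{1..}\<close>, so the value at \<open>0\<close> carries no information.\<close>

definition board :: "(nat \<Rightarrow> bool) measure" where
  "board = Pi\<^sub>M {1..} (\<lambda>_. measure_pmf (bernoulli_pmf (1 / 2)))"

text \<open>The cells \<open>a, \<dots>, b\<close> form a black string. An infinite run of black cells is not a string,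
  since a string is bounded on the right by a white cell.\<close>

definition black_string :: "(nat \<Rightarrow> bool) \<Rightarrow> nat \<Rightarrow> nat \<Rightarrow> bool" where
  "black_string \<omega> a b \<longleftrightarrow>
     1 \<le> a \<and> a \<le> b \<and> (\<forall>i\<in>{a..b}. \<omega> i) \<and> \<not> \<omega> (b + 1) \<and> (a = 1 \<or> \<not> \<omega> (a - 1))"

definition special_string :: "nat \<Rightarrow> (nat \<Rightarrow> bool) \<Rightarrow> nat \<Rightarrow> nat \<Rightarrow> bool" where
  "special_string s \<omega> a b \<longleftrightarrow>
     black_string \<omega> a b \<and> (\<exists>k. card {a..b} = s * k + (s - 1))"

text \<open>The leftmost special string is the one with the least first cell \<open>a\<close>; a string is
  determined by its first cell, so the last cell \<open>b\<close> is then unique.\<close>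

definition first_end :: "nat \<Rightarrow> (nat \<Rightarrow> bool) \<Rightarrow> enat" where
  "first_end s \<omega> =
     (if \<exists>a b. special_string s \<omega> a b
      then enat (THE b. special_string s \<omega> (LEAST a. \<exists>b. special_string s \<omega> a b) b)
      else \<infinity>)"

end

theory Submission imports Defs begin

text \<open>Cut the board from left to right into tiles of size at most \<open>s\<close>: a tile ends at its first
  white cell, or after \<open>s\<close> black cells. Cutting off a full black tile does not change the length
  of the current black string modulo \<open>s\<close>, so the first string of length congruent to \<open>s - 1\<close>
  ends at \<open>n\<close> exactly when the cells \<open>n + 2 - s, \<dots>, n + 1\<close> form the first tile of the shape
  black\<open>\<^sup>s\<^sup>-\<^sup>1\<close>white. The sizes of the tiles before it form an arbitrary composition of
  \<open>n + 1 - s\<close> into parts at most \<open>s\<close>, and they determine the first \<open>n + 1\<close> cells.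

  The series is evaluated by the renewal equation for \<open>c m / 2 ^ m\<close>, where \<open>c m\<close> is the number of
  compositions of \<open>m\<close>: its sum \<open>S\<close> satisfies \<open>S = 1 + (1 - 2 ^ -s) S\<close>.\<close>

section \<open>Black strings and the least end of a special one\<close>

definition special_end :: "nat \<Rightarrow> (nat \<Rightarrow> bool) \<Rightarrow> nat \<Rightarrow> bool" where
  "special_end s \<omega> b \<longleftrightarrow> (\<exists>a. special_string s \<omega> a b)"

lemma black_string_end_unique:
  assumes "black_string \<omega> a b" "black_string \<omega> a b'"
  shows "b = b'"
proof -
  have "\<not> b < b'" if "black_string \<omega> a b" "black_string \<omega> a b'" for b b'
    using that by (auto simp: black_string_def Ball_def)
  with assms show ?thesis
    by (meson linorder_neqE_nat)
qed

text \<open>Otherwise the white cell \<open>a' - 1\<close> to the left of the second string would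
  lie inside the first.\<close>

lemma black_string_end_less:
  assumes "black_string \<omega> a b" "black_string \<omega> a' b'" "a < a'"
  shows "b < b'"
proof (rule ccontr)
  assume "\<not> b < b'"
  with assms have "a' - 1 \<in> {a..b}" "a' \<noteq> 1"
    by (auto simp: black_string_def)
  with assms show False
    by (auto simp: black_string_def)
qed

text \<open>Strings are ordered alike by their first and by their last cells. This trades
  \<open>LEAST\<close> and \<open>THE\<close> for a condition on ends alone, which behaves well
  under shifts of the board.\<close>

lemma first_end_eq_enat_iff:
  "first_end s \<omega> = enat n \<longleftrightarrow> special_end s \<omega> n \<and> (\<forall>m<n. \<not> special_end s \<omega> m)"
proof (cases "\<exists>a b. special_string s \<omega> a b")
  case True
  define a where "a = (LEAST a. \<exists>b. special_string s \<omega> a b)"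
  obtain b where b: "special_string s \<omega> a b"
    using LeastI_ex[OF True] unfolding a_def by blast
  have least: "a \<le> a'" if "special_string s \<omega> a' b'" for a' b'
    unfolding a_def using that by (blast intro: Least_le)
  have uniq: "b' = b" if "special_string s \<omega> a b'" for b'
    using b that black_string_end_unique unfolding special_string_def by blast
  have "(THE b. special_string s \<omega> a b) = b"
    using b uniq by (rule the_equality)
  then have fe: "first_end s \<omega> = enat b"
    using True by (simp add: first_end_def a_def)
  have le: "b \<le> m" if m: "special_end s \<omega> m" for m
  proof -
    obtain a' where a': "special_string s \<omega> a' m"
      using m by (auto simp: special_end_def)
    show ?thesis
    proof (cases "a' = a")
      case True
      then show ?thesis using a' uniq by simp
    next
      case False
      then have "a < a'" using least[OF a'] by simp
      then show ?thesis
        using black_string_end_less b a' by (meson less_imp_le special_string_def)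
    qed
  qed
  have "special_end s \<omega> b"
    using b by (auto simp: special_end_def)
  with le fe show ?thesis
    by (metis enat.inject leD le_neq_implies_less)
next
  case False
  then show ?thesis
    by (simp add: first_end_def special_end_def)
qed

section \<open>Tiles as colour patterns\<close>

text \<open>The last entry covers both shapes: a tile shorter than \<open>s\<close> is closed by a
  white cell, the tile of size \<open>s\<close> is entirely black.\<close>

definition tile_code :: "nat \<Rightarrow> nat \<Rightarrow> bool list" where
  "tile_code s r = replicate (r - 1) True @ [r = s]"

text \<open>For \<open>s\<close> \<ge> 1 this is the only pattern of \<open>s\<close> cells that
  does not begin with a tile, so it can serve as an end marker.\<close>

definition final_code :: "nat \<Rightarrow> bool list" where
  "final_code s = replicate (s - 1) True @ [False]"

definition word :: "nat \<Rightarrow> nat list \<Rightarrow> bool list" where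
  "word s ps = concat (map (tile_code s) ps) @ final_code s"

definition cells :: "nat \<Rightarrow> (nat \<Rightarrow> bool) \<Rightarrow> bool list" where
  "cells n \<omega> = map \<omega> [1..<Suc n]"

lemma word_Nil [simp]: "word s [] = final_code s"
  and word_Cons [simp]: "word s (r # ps) = tile_code s r @ word s ps"
  by (simp_all add: word_def)

lemma length_cells [simp]: "length (cells n \<omega>) = n"
  by (simp add: cells_def)

lemma nth_cells [simp]: "i < n \<Longrightarrow> cells n \<omega> ! i = \<omega> (Suc i)"
  by (simp add: cells_def del: upt_Suc)

lemma length_tile_code [simp]: "1 \<le> r \<Longrightarrow> length (tile_code s r) = r"
  by (simp add: tile_code_def)

lemma length_final_code [simp]: "1 \<le> s \<Longrightarrow> length (final_code s) = s"
  by (simp add: final_code_def)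

lemma length_word:
  "set ps \<subseteq> {1..s} \<Longrightarrow> 1 \<le> s \<Longrightarrow> length (word s ps) = sum_list ps + s"
  by (induction ps) auto

lemma cells_add: "cells (r + n) \<omega> = cells r \<omega> @ cells n (\<lambda>i. \<omega> (i + r))"
  by (rule nth_equalityI) (auto simp: nth_append)

lemma cells_eq_tile_code_iff:
  assumes "1 \<le> r"
  shows "cells r \<omega> = tile_code s r \<longleftrightarrow> (\<forall>i. 1 \<le> i \<and> i < r \<longrightarrow> \<omega> i) \<and> (\<omega> r \<longleftrightarrow> r = s)"
proof -
  obtain k where r: "r = Suc k" using assms by (cases r) auto
  have "cells r \<omega> = tile_code s r \<longleftrightarrow> (\<forall>i<k. \<omega> (Suc i)) \<and> (\<omega> r \<longleftrightarrow> r = s)"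
  proof -
    have "cells r \<omega> = cells k \<omega> @ [\<omega> r]"
      by (simp add: cells_def r)
    moreover have "cells k \<omega> = replicate k True \<longleftrightarrow> (\<forall>i<k. \<omega> (Suc i))"
      by (auto simp: list_eq_iff_nth_eq)
    ultimately show ?thesis
      by (auto simp: tile_code_def r)
  qed
  also have "(\<forall>i<k. \<omega> (Suc i)) \<longleftrightarrow> (\<forall>i. 1 \<le> i \<and> i < r \<longrightarrow> \<omega> i)"
    by (metis One_nat_def Suc_le_D Suc_less_eq le_eq_less_or_eq not_less_eq_eq r zero_le)
  finally show ?thesis .
qed

lemma cells_eq_final_code_iff:
  assumes "1 \<le> s"
  shows "cells s \<omega> = final_code s \<longleftrightarrow> (\<forall>i. 1 \<le> i \<and> i < s \<longrightarrow> \<omega> i) \<and> \<not> \<omega> s"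
proof -
  \<comment> \<open>With maximal size \<open>Suc s\<close>, the tile of size \<open>s\<close> is a
    short one and ends in white.\<close>
  have "final_code s = tile_code (Suc s) s"
    by (simp add: final_code_def tile_code_def)
  then show ?thesis
    using cells_eq_tile_code_iff[OF assms, of \<omega> "Suc s"] by simp
qed

text \<open>Look for the first white cell among cells \<open>1\<close> to \<open>s\<close>: at
  \<open>s\<close> it gives the final pattern, earlier a short tile, and if there is none, the full
  black tile.\<close>

lemma first_tile_cases:
  assumes "1 \<le> s"
  obtains "cells s \<omega> = final_code s"
  | r where "r \<in> {1..s}" "cells r \<omega> = tile_code s r"
proof (cases "\<exists>r. 1 \<le> r \<and> r \<le> s \<and> \<not> \<omega> r")
  case True
  define r where "r = (LEAST r. 1 \<le> r \<and> r \<le> s \<and> \<not> \<omega> r)"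
  have r: "1 \<le> r \<and> r \<le> s \<and> \<not> \<omega> r"
    unfolding r_def by (rule LeastI_ex[OF True])
  have black: "\<omega> i" if "1 \<le> i \<and> i < r" for i
    using not_less_Least[of i "\<lambda>r. 1 \<le> r \<and> r \<le> s \<and> \<not> \<omega> r"] that r
    unfolding r_def[symmetric] by auto
  show ?thesis
  proof (cases "r = s")
    case True
    then show ?thesis
      using that(1) r black assms by (simp add: cells_eq_final_code_iff)
  next
    case False
    then show ?thesis
      using that(2)[of r] r black by (simp add: cells_eq_tile_code_iff)
  qed
next
  case False
  then show ?thesis
    using that(2)[of s] assms by (auto simp: cells_eq_tile_code_iff)
qed

section \<open>Effect of removing the first tile\<close>

lemma black_string_start_eq_1:
  assumes "black_string \<omega> a b" "a \<le> r" "\<And>i. 1 \<le> i \<Longrightarrow> i < r \<Longrightarrow> \<omega> i"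
  shows "a = 1"
proof (rule ccontr)
  assume "a \<noteq> 1"
  with assms(1) have "\<not> \<omega> (a - 1)" "1 \<le> a - 1"
    by (auto simp: black_string_def)
  with assms show False by auto
qed

lemma ball_atLeastAtMost_add:
  "(\<forall>i\<in>{a + r..b + r}. P i) \<longleftrightarrow> (\<forall>i\<in>{a..b}. P (i + r))" for r :: nat
  by (subst image_add_atLeastAtMost'[symmetric]) blast

text \<open>After the shift, cell \<open>Suc r\<close> becomes cell \<open>1\<close>, whose left
  neighbour is no longer tested; the second hypothesis supplies the white neighbour lost
  there.\<close>

lemma black_string_shift:
  assumes "r < a" and "a = Suc r \<Longrightarrow> \<not> \<omega> r"
  shows "black_string \<omega> a b \<longleftrightarrow> r \<le> b \<and> black_string (\<lambda>i. \<omega> (i + r)) (a - r) (b - r)"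
proof -
  obtain k where a: "a = Suc k + r" using assms(1) less_iff_Suc_add by (metis add.commute add_Suc)
  show ?thesis
  proof (cases "r \<le> b")
    case True
    then obtain d where b: "b = d + r" by (metis add.commute le_Suc_ex)
    have ball: "(\<forall>i\<in>{a..b}. \<omega> i) \<longleftrightarrow> (\<forall>i\<in>{Suc k..d}. \<omega> (i + r))"
      unfolding a b by (rule ball_atLeastAtMost_add)
    show ?thesis
      unfolding black_string_def ball using assms(2) by (cases k) (auto simp: a b)
  next
    case False
    then show ?thesis using assms(1) by (auto simp: black_string_def)
  qed
qed

text \<open>A short tile contains at most a string of \<open>r - 1 < s - 1\<close> cells, too short
  to be special. A full tile is the beginning of the string at cell \<open>1\<close>, if that string
  ends at all; removing it lowers the length by \<open>s\<close> and keeps the residue. All other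
  strings just move.\<close>

lemma special_end_shift:
  assumes s: "2 \<le> s" and r: "r \<in> {1..s}" and tile: "cells r \<omega> = tile_code s r"
  shows "special_end s \<omega> b \<longleftrightarrow> r \<le> b \<and> special_end s (\<lambda>i. \<omega> (i + r)) (b - r)"
proof -
  have black: "\<And>i. 1 \<le> i \<Longrightarrow> i < r \<Longrightarrow> \<omega> i" and last: "\<omega> r \<longleftrightarrow> r = s"
    using tile r by (auto simp: cells_eq_tile_code_iff)
  define \<omega>' where "\<omega>' = (\<lambda>i. \<omega> (i + r))"
  have far: "special_string s \<omega> a b \<longleftrightarrow> r \<le> b \<and> special_string s \<omega>' (a - r) (b - r)"
    if "r < a" "a = Suc r \<Longrightarrow> \<not> \<omega> r" for a
  proof (cases "r \<le> b")
    case True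
    have "card {a - r..b - r} = card {a..b}"
      using that(1) True by simp
    then show ?thesis
      unfolding special_string_def \<omega>'_def using black_string_shift[of r a \<omega> b, OF that] by auto
  next
    case False
    then show ?thesis
      using that(1) by (auto simp: special_string_def black_string_def)
  qed
  have "special_end s \<omega> b \<longleftrightarrow> r \<le> b \<and> special_end s \<omega>' (b - r)"
  proof (cases "r = s")
    case False
    \<comment> \<open>A string starting in a short tile starts at cell \<open>1\<close> and stops
      before the white cell \<open>r\<close>.\<close>
    have near: "\<not> special_string s \<omega> a b" if "a \<le> r" for a
    proof
      assume sp: "special_string s \<omega> a b"
      then have bs: "black_string \<omega> a b" by (simp add: special_string_def)
      then have "a = 1" using that black by (rule black_string_start_eq_1)
      with bs have "b < r"
        using False last r by (auto simp: black_string_def intro: ccontr)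
      then have "b < s - 1" using False r by auto
      then show False using sp \<open>a = 1\<close> by (auto simp: special_string_def)
    qed
    show ?thesis
    proof
      assume "special_end s \<omega> b"
      then obtain a where a: "special_string s \<omega> a b" by (auto simp: special_end_def)
      then have "r < a" using near by (meson not_le)
      then show "r \<le> b \<and> special_end s \<omega>' (b - r)"
        using far[of a] a last False by (auto simp: special_end_def)
    next
      assume "r \<le> b \<and> special_end s \<omega>' (b - r)"
      then obtain a where a: "special_string s \<omega>' a (b - r)" "r \<le> b"
        by (auto simp: special_end_def)
      then have "1 \<le> a" by (auto simp: special_string_def black_string_def)
      then show "special_end s \<omega> b"
        using far[of "a + r"] a last False by (auto simp: special_end_def)
    qed
  next
    case True
    \<comment> \<open>This string loses \<open>s\<close> cells but still starts at cell
      \<open>1\<close>, so \<open>far\<close> does not cover it.\<close>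
    have first: "special_string s \<omega> 1 b \<longleftrightarrow> r \<le> b \<and> special_string s \<omega>' 1 (b - r)"
    proof (cases "r < b")
      case lt: True
      have white: "\<omega> (b + 1) \<longleftrightarrow> \<omega>' (b - r + 1)"
        using lt by (simp add: \<omega>'_def)
      have blacks: "(\<forall>i\<in>{1..b}. \<omega> i) \<longleftrightarrow> (\<forall>i\<in>{1..b - r}. \<omega>' i)"
      proof -
        have eq: "{1..b} = {1..r} \<union> {1 + r..b - r + r}"
          using lt by auto
        have "\<forall>i\<in>{1..r}. \<omega> i"
          using black last True by (auto simp: le_less)
        then have "(\<forall>i\<in>{1..b}. \<omega> i) \<longleftrightarrow> (\<forall>i\<in>{1 + r..b - r + r}. \<omega> i)"
          unfolding eq ball_Un by blast
        then show ?thesis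
          unfolding ball_atLeastAtMost_add \<omega>'_def .
      qed
      \<comment> \<open>The shift replaces \<open>k\<close> by \<open>k - 1\<close>; here
        \<open>k = 0\<close> is excluded because \<open>b > s\<close>.\<close>
      have len: "(\<exists>k. card {1..b} = s * k + (s - 1)) \<longleftrightarrow>
                 (\<exists>k. card {1..b - r} = s * k + (s - 1))"
      proof
        assume "\<exists>k. card {1..b} = s * k + (s - 1)"
        then obtain k where k: "b = s * k + (s - 1)" by auto
        with lt True obtain j where "k = Suc j" by (cases k) auto
        with k True have "card {1..b - r} = s * j + (s - 1)" by simp
        then show "\<exists>k. card {1..b - r} = s * k + (s - 1)" ..
      next
        assume "\<exists>k. card {1..b - r} = s * k + (s - 1)"
        then obtain k where "b - r = s * k + (s - 1)" by auto
        then have "card {1..b} = s * Suc k + (s - 1)" using lt True by simp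
        then show "\<exists>k. card {1..b} = s * k + (s - 1)" ..
      qed
      show ?thesis
        unfolding special_string_def black_string_def len white blacks using lt by auto
    next
      case False
      \<comment> \<open>The string covers the whole tile, so \<open>b = s\<close>; but
        \<open>s\<close> is not congruent to \<open>s - 1\<close> modulo \<open>s\<close>, as
        \<open>s\<close> \<ge> 2.\<close>
      moreover have "\<not> special_string s \<omega> 1 b"
      proof
        assume sp: "special_string s \<omega> 1 b"
        then have "\<not> \<omega> (b + 1)"
          by (simp add: special_string_def black_string_def)
        then have "\<not> b < r"
          using black[of "b + 1"] last True by (cases "b + 1 = r") auto
        with False have "b = s" using True by simp
        with sp obtain k where "s = s * k + (s - 1)"
          by (auto simp: special_string_def)
        then show False using s by (cases k) auto
      qed
      ultimately show ?thesis by (auto simp: special_string_def black_string_def)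
    qed
    \<comment> \<open>Cells \<open>1\<close> to \<open>r\<close> are black, so no string starts at
      \<open>2\<close> to \<open>Suc r\<close>; past these, the side condition of \<open>far\<close>
      is vacuous.\<close>
    have shape: "a = 1 \<or> Suc r < a" if "special_string s \<omega> a b" for a
    proof -
      have bs: "black_string \<omega> a b" using that by (simp add: special_string_def)
      have "a = 1" if "a \<le> Suc r"
        by (rule black_string_start_eq_1[OF bs that]) (use black last True in \<open>auto simp: less_Suc_eq\<close>)
      then show ?thesis by auto
    qed
    show ?thesis
    proof
      assume "special_end s \<omega> b"
      then obtain a where a: "special_string s \<omega> a b" by (auto simp: special_end_def)
      from shape[OF this] show "r \<le> b \<and> special_end s \<omega>' (b - r)"
        using a first far[of a] by (auto simp: special_end_def)
    next
      assume "r \<le> b \<and> special_end s \<omega>' (b - r)"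
      then obtain a where a: "special_string s \<omega>' a (b - r)" "r \<le> b"
        by (auto simp: special_end_def)
      then have "1 \<le> a" by (auto simp: special_string_def black_string_def)
      \<comment> \<open>A string at the start of the remaining board is prolonged to the left by the
        black tile; any other keeps its length.\<close>
      then consider "a = 1" | "1 < a" by linarith
      then show "special_end s \<omega> b"
      proof cases
        case 1
        then show ?thesis using first a by (auto simp: special_end_def)
      next
        case 2
        then show ?thesis using far[of "a + r"] a by (auto simp: special_end_def)
      qed
    qed
  qed
  then show ?thesis by (simp add: \<omega>'_def)
qed

text \<open>Special ends correspond under the shift and none lies below \<open>r\<close>, so
  minimality carries over.\<close>

lemma first_end_shift:
  assumes "2 \<le> s" "r \<in> {1..s}" "cells r \<omega> = tile_code s r"
  shows "first_end s \<omega> = enat n \<longleftrightarrow> r \<le> n \<and> first_end s (\<lambda>i. \<omega> (i + r)) = enat (n - r)"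
proof -
  note shift = special_end_shift[OF assms]
  have "(\<forall>m<n. \<not> special_end s \<omega> m) \<longleftrightarrow> (\<forall>m<n - r. \<not> special_end s (\<lambda>i. \<omega> (i + r)) m)"
    if "r \<le> n"
  proof
    assume L: "\<forall>m<n. \<not> special_end s \<omega> m"
    show "\<forall>m<n - r. \<not> special_end s (\<lambda>i. \<omega> (i + r)) m"
    proof (intro allI impI)
      fix m assume "m < n - r"
      then show "\<not> special_end s (\<lambda>i. \<omega> (i + r)) m"
        using L[rule_format, of "m + r"] shift[of "m + r"] by simp
    qed
  next
    assume "\<forall>m<n - r. \<not> special_end s (\<lambda>i. \<omega> (i + r)) m"
    then show "\<forall>m<n. \<not> special_end s \<omega> m"
      using shift by auto
  qed
  then show ?thesis
    using shift[of n] by (auto simp: first_end_eq_enat_iff)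
qed

lemma first_end_final_code:
  assumes s: "2 \<le> s" and "cells s \<omega> = final_code s"
  shows "first_end s \<omega> = enat (s - 1)"
proof -
  have black: "\<And>i. 1 \<le> i \<Longrightarrow> i < s \<Longrightarrow> \<omega> i" and white: "\<not> \<omega> s"
    using assms by (auto simp: cells_eq_final_code_iff)
  have "card {1..s - 1} = s * 0 + (s - 1)" by simp
  then have "\<exists>k. card {1..s - 1} = s * k + (s - 1)" ..
  then have "special_string s \<omega> 1 (s - 1)"
    using s black white by (auto simp: special_string_def black_string_def)
  then have "special_end s \<omega> (s - 1)" by (auto simp: special_end_def)
  moreover have "\<not> special_end s \<omega> m" if "m < s - 1" for m
    using that black[of "m + 1"] by (auto simp: special_end_def special_string_def black_string_def)
  ultimately show ?thesis by (simp add: first_end_eq_enat_iff)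
qed

section \<open>Unique decoding, and the first end in terms of words\<close>

text \<open>The tiles form a prefix code: where the shorter of two tiles has its white cell, the
  longer one is still black.\<close>

lemma tile_code_append_eq:
  assumes "r \<in> {1..s}" "q \<in> {1..s}" "tile_code s r @ u = tile_code s q @ v"
  shows "r = q \<and> u = v"
proof -
  have False if "r < q" "1 \<le> r" "q \<le> s" "tile_code s r @ u = tile_code s q @ v" for r q u v
    using arg_cong[OF that(4), of "\<lambda>xs. xs ! (r - 1)"] that(1-3)
    by (auto simp: tile_code_def nth_append split: if_splits)
  from this[of r q u v] this[of q r v u] have "r = q"
    using assms by (metis atLeastAtMost_iff linorder_neqE_nat)
  with assms show ?thesis by simp
qed

text \<open>At index \<open>r - 1\<close> the tile is white exactly if \<open>r < s\<close>, the
  final pattern exactly if \<open>r = s\<close>.\<close>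

lemma final_code_neq_tile_code_append:
  assumes "r \<in> {1..s}"
  shows "final_code s \<noteq> tile_code s r @ v"
proof
  assume "final_code s = tile_code s r @ v"
  from arg_cong[OF this, of "\<lambda>xs. xs ! (r - 1)"] assms show False
    by (auto simp: tile_code_def final_code_def nth_append split: if_splits)
qed

text \<open>Tiles can be read off one by one from the left. This will make the events of different
  compositions disjoint.\<close>

lemma inj_on_word: "inj_on (word s) {ps. set ps \<subseteq> {1..s}}"
proof -
  have "ps = qs" if "set ps \<subseteq> {1..s}" "set qs \<subseteq> {1..s}" "word s ps = word s qs" for ps qs
    using that
  proof (induction ps arbitrary: qs)
    case Nil
    then show ?case
      using final_code_neq_tile_code_append by (cases qs) auto
  next
    case (Cons r ps)
    then obtain q qs' where qs: "qs = q # qs'"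
      using final_code_neq_tile_code_append[of r s] by (cases qs) (auto dest: sym)
    with Cons.prems have "r = q \<and> word s ps = word s qs'"
      by (intro tile_code_append_eq) auto
    with Cons qs show ?case by auto
  qed
  then show ?thesis by (auto intro: inj_onI)
qed

text \<open>Induction on \<open>n\<close>, removing the first tile; \<omega> must vary since the
  board is shifted. \<open>Suc n\<close> cells are needed because the white cell after the string
  belongs to the final pattern.\<close>

lemma first_end_iff_word:
  assumes s: "2 \<le> s"
  shows "first_end s \<omega> = enat n \<longleftrightarrow>
    (\<exists>ps. set ps \<subseteq> {1..s} \<and> sum_list ps + s = Suc n \<and> cells (Suc n) \<omega> = word s ps)"
proof (induction n arbitrary: \<omega> rule: less_induct)
  case (less n)
  from s have s1: "1 \<le> s" by simp
  show ?case (is "_ \<longleftrightarrow> ?R")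
  proof (rule first_tile_cases[OF s1, of \<omega>])
    assume fin: "cells s \<omega> = final_code s"
    have "?R \<longleftrightarrow> Suc n = s"
    proof
      assume "Suc n = s"
      then show ?R using fin by (intro exI[of _ "[]"]) auto
    next
      assume ?R
      then obtain ps where ps: "set ps \<subseteq> {1..s}" "sum_list ps + s = Suc n"
        "cells (Suc n) \<omega> = word s ps" by blast
      show "Suc n = s"
      proof (cases ps)
        case Nil
        then show ?thesis using ps by simp
      next
        case (Cons r qs)
        have "Suc n = s + sum_list ps" using ps by simp
        then have "final_code s @ cells (sum_list ps) (\<lambda>i. \<omega> (i + s)) = tile_code s r @ word s qs"
          using ps(3) cells_add[of s "sum_list ps" \<omega>] fin Cons by simp
        \<comment> \<open>Since \<open>r\<close> \<le> \<open>s\<close>, the tile survives the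
          truncation and would be a prefix of the final pattern.\<close>
        then have "take s (tile_code s r @ word s qs) = final_code s"
          using s1 by (metis append_eq_conv_conj length_final_code)
        moreover have r: "r \<in> {1..s}" using ps Cons by simp
        ultimately have "final_code s = tile_code s r @ take (s - r) (word s qs)"
          by simp
        with final_code_neq_tile_code_append[OF r] show ?thesis by blast
      qed
    qed
    then show ?thesis
      using first_end_final_code[OF s fin] s by auto
  next
    fix r assume r: "r \<in> {1..s}" and tile: "cells r \<omega> = tile_code s r"
    define \<omega>' where "\<omega>' = (\<lambda>i. \<omega> (i + r))"
    have "first_end s \<omega> = enat n \<longleftrightarrow> r \<le> n \<and> (\<exists>ps. set ps \<subseteq> {1..s} \<and>
        sum_list ps + s = Suc (n - r) \<and> cells (Suc (n - r)) \<omega>' = word s ps)"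
      using first_end_shift[OF s r tile, of n] less.IH[of "n - r" \<omega>'] r by (auto simp: \<omega>'_def)
    also have "\<dots> \<longleftrightarrow> ?R"
    proof
      assume L: "r \<le> n \<and> (\<exists>ps. set ps \<subseteq> {1..s} \<and>
        sum_list ps + s = Suc (n - r) \<and> cells (Suc (n - r)) \<omega>' = word s ps)"
      then obtain ps where ps: "r \<le> n" "set ps \<subseteq> {1..s}" "sum_list ps + s = Suc (n - r)"
        "cells (Suc (n - r)) \<omega>' = word s ps" by blast
      have "cells (Suc n) \<omega> = tile_code s r @ word s ps"
        using cells_add[of r "Suc (n - r)" \<omega>] ps tile by (simp add: \<omega>'_def)
      then show ?R using ps r by (intro exI[of _ "r # ps"]) auto
    next
      assume ?R
      then obtain ps where ps: "set ps \<subseteq> {1..s}" "sum_list ps + s = Suc n"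
        "cells (Suc n) \<omega> = word s ps" by blast
      have "r \<le> Suc n" using ps r by auto
      then have split: "cells (Suc n) \<omega> = tile_code s r @ cells (Suc n - r) \<omega>'"
        using cells_add[of r "Suc n - r" \<omega>] tile by (simp add: \<omega>'_def)
      then obtain q qs where q: "ps = q # qs"
        using ps final_code_neq_tile_code_append[OF r] by (cases ps) (auto dest: sym)
      with ps r split have "r = q \<and> cells (Suc n - r) \<omega>' = word s qs"
        by (intro tile_code_append_eq) auto
      moreover have "r \<le> n" using ps q calculation s1 by auto
      ultimately show "r \<le> n \<and> (\<exists>ps. set ps \<subseteq> {1..s} \<and>
        sum_list ps + s = Suc (n - r) \<and> cells (Suc (n - r)) \<omega>' = word s ps)"
        using ps q by (auto simp: Suc_diff_le intro!: exI[of _ qs])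
    qed
    finally show ?thesis .
  qed
qed

section \<open>Counting compositions\<close>

lemma finite_compositions [simp]: "finite (compositions s n)"
proof (rule finite_subset)
  have "length ps \<le> sum_list ps" if "set ps \<subseteq> {1..s}" for ps
    using that by (induction ps) auto
  then show "compositions s n \<subseteq> {ps. set ps \<subseteq> {1..s} \<and> length ps \<le> n}"
    by (auto simp: compositions_def)
  show "finite {ps. set ps \<subseteq> {1..s} \<and> length ps \<le> n}"
    by (rule finite_lists_length_le) simp
qed

lemma compositions_0 [simp]: "compositions s 0 = {[]}"
proof -
  have "ps = []" if "ps \<in> compositions s 0" for ps
    using that by (cases ps) (auto simp: compositions_def)
  then show ?thesis by (auto simp: compositions_def)
qed

lemma compositions_pos:
  assumes "0 < n"
  shows "compositions s n = (\<Union>r\<in>{r\<in>{1..s}. r \<le> n}. (#) r ` compositions s (n - r))"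
proof (intro set_eqI iffI)
  fix ps assume "ps \<in> compositions s n"
  with assms obtain r qs where "ps = r # qs" "set ps \<subseteq> {1..s}" "sum_list ps = n"
    by (cases ps) (auto simp: compositions_def)
  then show "ps \<in> (\<Union>r\<in>{r\<in>{1..s}. r \<le> n}. (#) r ` compositions s (n - r))"
    by (auto simp: compositions_def)
qed (auto simp: compositions_def)

text \<open>Classify by the first part. The \<open>if\<close> keeps the range of \<open>r\<close>
  independent of \<open>n\<close>, so that sums over both can be exchanged.\<close>

lemma card_compositions_pos:
  assumes "0 < n"
  shows "card (compositions s n) = (\<Sum>r=1..s. if r \<le> n then card (compositions s (n - r)) else 0)"
proof -
  have "card (compositions s n) =
      (\<Sum>r\<in>{r\<in>{1..s}. r \<le> n}. card ((#) r ` compositions s (n - r)))"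
    unfolding compositions_pos[OF assms] by (rule card_UN_disjoint) auto
  also have "\<dots> = (\<Sum>r\<in>{r\<in>{1..s}. r \<le> n}. card (compositions s (n - r)))"
    by (simp add: card_image)
  finally show ?thesis
    by (simp add: sum.inter_filter[symmetric])
qed

section \<open>Probabilities of initial colour patterns\<close>

lemma space_board: "space board = PiE {1..} (\<lambda>_. UNIV)"
  by (simp add: board_def space_PiM)

text \<open>Fixing the first cells gives a cylinder set, with a factor 1/2 for each fixed
  coordinate; cell \<open>i\<close> has list index \<open>i - 1\<close>.\<close>

lemma
  fixes w :: "bool list"
  defines "C \<equiv> {\<omega> \<in> space board. cells (length w) \<omega> = w}"
  shows sets_cells: "C \<in> sets board"
    and measure_cells: "measure board C = 1 / 2 ^ length w"
proof -
  let ?M = "\<lambda>_::nat. measure_pmf (bernoulli_pmf (1 / 2))"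
  interpret product_prob_space ?M "{1::nat..}" ..
  let ?J = "{1..length w}"
  have C: "C = prod_emb {1..} ?M ?J (PiE ?J (\<lambda>i. {w ! (i - 1)}))"
  proof -
    have "cells (length w) \<omega> = w \<longleftrightarrow> (\<forall>i\<in>?J. \<omega> i = w ! (i - 1))" for \<omega>
    proof
      assume "cells (length w) \<omega> = w"
      then have "\<omega> (Suc j) = w ! j" if "j < length w" for j
        using that nth_cells by metis
      then show "\<forall>i\<in>?J. \<omega> i = w ! (i - 1)"
        by (metis One_nat_def Suc_le_D Suc_le_eq atLeastAtMost_iff diff_Suc_1)
    qed (auto intro!: nth_equalityI)
    then show ?thesis
      by (auto simp: C_def space_board prod_emb_def restrict_PiE_iff Pi_iff)
  qed
  show "C \<in> sets board"
    unfolding C board_def by (rule sets_PiM_I) auto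
  have "measure board C = (\<Prod>i\<in>?J. measure (?M i) {w ! (i - 1)})"
    unfolding C board_def by (rule measure_PiM_emb) auto
  also have "\<dots> = (\<Prod>i\<in>?J. 1 / 2)"
  proof (rule prod.cong)
    fix i
    show "measure (?M i) {w ! (i - 1)} = 1 / 2"
      by (cases "w ! (i - 1)") (simp_all add: measure_pmf_single)
  qed simp
  also have "\<dots> = 1 / 2 ^ length w"
    by (simp add: power_one_over)
  finally show "measure board C = 1 / 2 ^ length w" .
qed

text \<open>The event is a disjoint union of cylinders, one per composition, each fixing exactly
  \<open>Suc n\<close> cells.\<close>

lemma measure_first_end:
  assumes s: "2 \<le> s" and n: "s \<le> Suc n"
  shows "measure board {\<omega> \<in> space board. first_end s \<omega> = enat n} =
    card (compositions s (Suc n - s)) / 2 ^ Suc n"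
proof -
  let ?P = "compositions s (Suc n - s)"
  define A where "A ps = {\<omega> \<in> space board. cells (Suc n) \<omega> = word s ps}" for ps
  interpret prob_space board
    unfolding board_def by (intro prob_space_PiM prob_space_measure_pmf)
  have len: "length (word s ps) = Suc n" if "ps \<in> ?P" for ps
    using that length_word[of ps s] s n by (auto simp: compositions_def)
  have A: "A ps \<in> sets board" "measure board (A ps) = 1 / 2 ^ Suc n" if "ps \<in> ?P" for ps
    using sets_cells[of "word s ps"] measure_cells[of "word s ps"] len[OF that]
    by (simp_all add: A_def)
  have "{\<omega> \<in> space board. first_end s \<omega> = enat n} = (\<Union>ps\<in>?P. A ps)"
    using n by (auto simp: first_end_iff_word[OF s] A_def compositions_def)
  also have "measure board \<dots> = (\<Sum>ps\<in>?P. measure board (A ps))"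
  proof (rule finite_measure_finite_Union)
    show "A ` ?P \<subseteq> sets board"
      using A(1) by blast
    show "disjoint_family_on A ?P"
    proof -
      have "A ps \<inter> A qs = {}" if "ps \<in> ?P" "qs \<in> ?P" "ps \<noteq> qs" for ps qs
      proof -
        have "word s ps \<noteq> word s qs"
          using inj_onD[OF inj_on_word, of s ps qs] that by (auto simp: compositions_def)
        then show ?thesis by (auto simp: A_def)
      qed
      then show ?thesis by (auto simp: disjoint_family_on_def)
    qed
  qed simp
  also have "\<dots> = (\<Sum>ps\<in>?P. 1 / 2 ^ Suc n)"
    by (intro sum.cong refl A(2))
  finally show ?thesis by simp
qed

section \<open>Summing the series\<close>

lemma sum_inverse_powers: "(\<Sum>r=1..s. (1 / 2) ^ r) = 1 - (1 / 2 :: real) ^ s"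
  by (induction s) auto

text \<open>The renewal equation is used twice: on partial sums it yields a bound and hence
  summability, in the limit it determines the value.\<close>

lemma card_compositions_sums:
  "(\<lambda>m. card (compositions s m) / 2 ^ m) sums (2 ^ s :: real)"
proof -
  define a :: "nat \<Rightarrow> real" where "a m = card (compositions s m) / 2 ^ m" for m
  have nonneg: "0 \<le> a m" for m by (simp add: a_def)
  \<comment> \<open>The sequence \<open>a\<close> delayed by \<open>r\<close> places, with zeros in
    front.\<close>
  define d where "d r m = (if r \<le> m then a (m - r) else 0)" for r m
  have renewal: "a m = (if m = 0 then 1 else 0) + (\<Sum>r=1..s. (1 / 2) ^ r * d r m)" for m
  proof (cases "m = 0")
    case False
    have "a m = (\<Sum>r=1..s. real (if r \<le> m then card (compositions s (m - r)) else 0) / 2 ^ m)"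
      using False by (simp add: a_def card_compositions_pos sum_divide_distrib)
    also have "\<dots> = (\<Sum>r=1..s. (1 / 2) ^ r * d r m)"
      by (intro sum.cong) (auto simp: d_def a_def power_diff power_one_over)
    finally show ?thesis using False by simp
  qed (simp add: a_def d_def)
  have partial: "(\<Sum>m<N. a m) \<le> 2 ^ s" for N
  proof -
    \<comment> \<open>Delaying pushes nonnegative terms out of the range and adds only
      zeros.\<close>
    have shifted: "(\<Sum>m<N. d r m) \<le> (\<Sum>m<N. a m)" for r
    proof -
      have "(\<Sum>m<N. d r m) = (\<Sum>m\<in>{m\<in>{..<N}. r \<le> m}. a (m - r))"
        by (simp add: d_def sum.inter_filter[symmetric])
      also have "\<dots> = (\<Sum>m\<in>(\<lambda>m. m - r) ` {m\<in>{..<N}. r \<le> m}. a m)"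
        by (subst sum.reindex) (auto simp: inj_on_def)
      also have "\<dots> \<le> (\<Sum>m<N. a m)"
        by (rule sum_mono2) (auto simp: nonneg)
      finally show ?thesis .
    qed
    let ?X = "\<Sum>m<N. a m"
    have "?X = (\<Sum>m<N. (if m = 0 then 1 else 0) + (\<Sum>r=1..s. (1 / 2) ^ r * d r m))"
      by (intro sum.cong refl renewal)
    also have "\<dots> = (\<Sum>m<N. if m = 0 then 1 else 0) + (\<Sum>r=1..s. (1 / 2) ^ r * (\<Sum>m<N. d r m))"
      unfolding sum.distrib sum_distrib_left by (subst (2) sum.swap) (rule refl)
    \<comment> \<open>The resulting coefficient \<open>1 - (1 / 2) ^ s\<close> of \<open>?X\<close>
      is below 1, so the inequality can be solved for \<open>?X\<close>.\<close>
    also have "\<dots> \<le> 1 + (\<Sum>r=1..s. (1 / 2) ^ r * ?X)"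
      by (intro add_mono sum_mono mult_left_mono shifted) (auto simp: sum.delta)
    also have "(\<Sum>r=1..s. (1 / 2) ^ r * ?X) = (1 - (1 / 2) ^ s) * ?X"
      by (simp only: sum_distrib_right[symmetric] sum_inverse_powers)
    finally have "(1 / 2) ^ s * ?X \<le> 1"
      by (simp add: left_diff_distrib)
    then show ?thesis
      by (simp add: power_one_over field_simps)
  qed
  have "summable a"
    using nonneg partial by (intro summableI_nonneg_bounded)
  then have S: "a sums suminf a" by (rule summable_sums)
  have "d r sums suminf a" for r
  proof -
    have "(\<lambda>m. d r (m + r)) sums suminf a"
      using S by (simp add: d_def)
    then show ?thesis
      by (subst (asm) sums_zero_iff_shift) (auto simp: d_def)
  qed
  then have "(\<lambda>m. (if m = 0 then 1 else 0) + (\<Sum>r=1..s. (1 / 2) ^ r * d r m)) sums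
      (1 + (\<Sum>r=1..s. (1 / 2) ^ r * suminf a))"
    by (intro sums_add sums_sum sums_mult sums_single)
  then have "a sums (1 + (1 - (1 / 2) ^ s) * suminf a)"
    by (simp only: renewal[symmetric] sum_distrib_right[symmetric] sum_inverse_powers)
  then have "suminf a = 1 + (1 - (1 / 2) ^ s) * suminf a"
    using S by (simp add: sums_unique2)
  then have "(1 / 2) ^ s * suminf a = 1"
    by (simp add: left_diff_distrib)
  then have "suminf a = 2 ^ s"
    by (simp add: power_one_over field_simps)
  with S show ?thesis by (simp add: a_def[abs_def])
qed

theorem theorem2p1:
  fixes s :: nat
  assumes "s \<ge> 2"
  shows "(\<forall>n\<ge>s - 1. measure board {\<omega> \<in> space board. first_end s \<omega> = enat n}
            = real (multibonacci s (n + 2 - s)) / 2 ^ (n + 1))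
       \<and> ((\<lambda>n. real (multibonacci s (n + 2 - s)) / 2 ^ n) has_sum 2) {s - 1..}"
proof (intro conjI allI impI)
  \<comment> \<open>For \<open>n\<close> \<ge> \<open>s - 1\<close> the index is a successor, so the
    value is a count of compositions.\<close>
  have mb: "multibonacci s (n + 2 - s) = card (compositions s (Suc n - s))" if "s - 1 \<le> n" for n
  proof -
    have "n + 2 - s = Suc (Suc n - s)" using that by simp
    then show ?thesis by simp
  qed
  show "measure board {\<omega> \<in> space board. first_end s \<omega> = enat n}
      = real (multibonacci s (n + 2 - s)) / 2 ^ (n + 1)" if "s - 1 \<le> n" for n
    using measure_first_end[OF assms, of n] mb[OF that] that by simp
  \<comment> \<open>Nonnegative terms allow passing from the ordered series to an unordered
    sum.\<close>
  have "((\<lambda>m. card (compositions s m) / 2 ^ m) has_sum (2 ^ s :: real)) UNIV"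
    by (rule sums_nonneg_imp_has_sum_strong[OF card_compositions_sums]) simp
  \<comment> \<open>The factor is \<open>1 / 2 ^ (s - 1)\<close>, which comes from the substitution
    \<open>n = m + (s - 1)\<close>.\<close>
  then have "((\<lambda>m. card (compositions s m) / 2 ^ m * (2 / 2 ^ s)) has_sum
      (2 ^ s * (2 / 2 ^ s) :: real)) UNIV"
    by (rule has_sum_cmult_left)
  also have "(\<lambda>m. card (compositions s m) / 2 ^ m * (2 / 2 ^ s :: real)) =
      (\<lambda>n. real (multibonacci s (n + 2 - s)) / 2 ^ n) \<circ> (\<lambda>m. m + (s - 1))"
  proof
    fix m
    obtain k where "s = Suc k"
      using assms by (cases s) auto
    then show "card (compositions s m) / 2 ^ m * (2 / 2 ^ s :: real) =
        ((\<lambda>n. real (multibonacci s (n + 2 - s)) / 2 ^ n) \<circ> (\<lambda>m. m + (s - 1))) m"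
      using mb[of "m + (s - 1)"] by (simp add: power_add)
  qed
  finally have "((\<lambda>n. real (multibonacci s (n + 2 - s)) / 2 ^ n) has_sum 2)
      ((\<lambda>m. m + (s - 1)) ` UNIV)"
    by (subst has_sum_reindex) (auto simp: o_def inj_on_def)
  moreover have "(\<lambda>m. m + (s - 1)) ` UNIV = {s - 1..}"
    by (auto simp: image_iff) (metis add.commute le_Suc_ex)
  ultimately show "((\<lambda>n. real (multibonacci s (n + 2 - s)) / 2 ^ n) has_sum 2) {s - 1..}"
    by simp
qed

end
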